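(* Let $u_{\max}>0$, let $f:[0,u_{\max}]\to\mathbb{R}_+$ be $\mathcal{C}^2$ and strictly concave, with $f''<0$ and $f(0)=f(u_{\max})=0$, and let $F$ be a primitive of $f$. Let $u$ be a weak entropy solution, with values in $[0,u_{\max}]$ and with initial data of bounded variation, of the initial--boundary value problem for $u_t+f(u)_x=0$ on $(a,b)$, and let $t\in[0,T]$ be a given time, with left boundary trace $u(t,a)$. Then there exist $\bar u, u^*\in[0,u_{\max}]$ and class $\mathcal{K}$ functions $\alpha,\beta$ such that the convex optimization problem $$\min_{\omega_b\in\mathcal{C}_b}\Big\{\omega_b^2 \;:\; g\big(u(t,a),\omega_b\big)\le -C(t),\quad k\big(u(t,a),\omega_b\big)\le D(t)\Big\}$$ is feasible, i.e. there is $\omega_b\in\mathcal{C}_b$ satisfying both constraints. Here $\mathcal{C}_b,g,k,C,D$ are as defined in the context ($\mathcal{C}_b$ and $g$ depend on $u^*$, $C$ on $u^*,\alpha$, and $D$ on $\bar u,\beta$).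
   Context: Setting: the initial--boundary value problem is $u_t+f(u)_x=0$ on $(a,b)$ with $u(0,x)=u_0(x)$, $u(t,a)=\omega_a(t)$, $u(t,b)=\omega_b(t)$, considered in the sense of weak entropy solutions with $u_0$ of bounded variation; $u(t,a),u(t,b)$ denote boundary traces. For $u^*\in[0,u_{\max}]$ (desired equilibrium density) and $\bar u\in[0,u_{\max}]$ define $$V(u(t))=\tfrac12\int_a^b (u(t,x)-u^* )^2\,dx,\qquad B(u(t))=\bar u^2-\int_a^b u(t,x)^2\,dx.$$ For class $\mathcal{K}$ functions $\alpha,\beta$ (continuous, strictly increasing, vanishing at $0$) set $$C(t)=\alpha(V(u(t)))\ge 0,\qquad D(t)=\beta(B(u(t)))\ge 0$$ (the nonnegativity of $D(t)$, i.e. $B(u(t))\ge 0$, is a standing convention). For $s,z\in[0,u_{\max}]$ define $$g(s,z)=(s-u^* )f(s)-(z-u^* )f(z)-F(s)+F(z),$$ $$k(s,z)=sf(s)-zf(z)-F(s)+F(z).$$ Define $\mathcal{C}_b=\{v\in[0,u_{\max}] : (v-u^* ) f''(v)+f'(v)\le 0\}$. It is a standing assumption (for simplicity) that $\mathcal{C}_b$ is a single interval $[u_1,u_{\max}]$, where $u_1$ solves $v+f'(v)/f''(v)=u^*$.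
   Formalization: Excluded: the case where no ū in [0,u_max] gives B>0, f'(u(t,a))=0, and u(t,·) is not a.e. equal to u(t,a); the problem is then infeasible for every choice. The convention B≥0 is taken as: some ū in [0,u_max] attains it. *)

theory Defs
  imports "HOL-Analysis.Analysis"
begin

section \<open>Fluxes\<close>

text \<open>
  The functions \<open>f'\<close>, \<open>f''\<close> are the derivatives on the closed interval, one-sided at its end points;
  nothing is said about values outside \<open>{0..umax}\<close>.
\<close>

definition concave_flux ::
    "real \<Rightarrow> (real \<Rightarrow> real) \<Rightarrow> (real \<Rightarrow> real) \<Rightarrow> (real \<Rightarrow> real) \<Rightarrow> bool" where
  "concave_flux umax f f' f'' \<longleftrightarrow>
     (\<forall>v\<in>{0..umax}. 0 \<le> f v) \<and>
     (\<forall>v\<in>{0..umax}. (f has_real_derivative f' v) (at v within {0..umax})) \<and>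
     (\<forall>v\<in>{0..umax}. (f' has_real_derivative f'' v) (at v within {0..umax})) \<and>
     continuous_on {0..umax} f'' \<and>
     (\<forall>v\<in>{0..umax}. \<forall>w\<in>{0..umax}. \<forall>\<theta>\<in>{0<..<1}.
        v \<noteq> w \<longrightarrow> (1 - \<theta>) * f v + \<theta> * f w < f ((1 - \<theta>) * v + \<theta> * w)) \<and>
     (\<forall>v\<in>{0..umax}. f'' v < 0) \<and>
     f 0 = 0 \<and> f umax = 0"

definition primitive_on :: "real set \<Rightarrow> (real \<Rightarrow> real) \<Rightarrow> (real \<Rightarrow> real) \<Rightarrow> bool" where
  "primitive_on S f F \<longleftrightarrow> (\<forall>v\<in>S. (F has_real_derivative f v) (at v within S))"


section \<open>Weak entropy solutions of the initial--boundary value problem\<close>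

definition bounded_variation_on :: "real set \<Rightarrow> (real \<Rightarrow> real) \<Rightarrow> bool" where
  "bounded_variation_on S v \<longleftrightarrow>
     (\<exists>M. \<forall>n (p :: nat \<Rightarrow> real). mono_on {..n} p \<and> p ` {..n} \<subseteq> S \<longrightarrow>
        (\<Sum>i<n. \<bar>v (p (Suc i)) - v (p i)\<bar>) \<le> M)"

text \<open>
  Traces are taken in the \<open>L\<^sup>1\<close> sense of BV theory, so that they depend only on the
  almost-everywhere class of the profile \<open>v\<close>. For a profile of bounded variation they are the one-sided limits.
\<close>

definition left_trace :: "real \<Rightarrow> (real \<Rightarrow> real) \<Rightarrow> real \<Rightarrow> bool" where
  "left_trace a v s \<longleftrightarrow>
     ((\<lambda>h. (LINT x:{a<..<a + h}|lebesgue. \<bar>v x - s\<bar>) / h) \<longlongrightarrow> 0) (at_right 0)"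

definition right_trace :: "real \<Rightarrow> (real \<Rightarrow> real) \<Rightarrow> real \<Rightarrow> bool" where
  "right_trace b v s \<longleftrightarrow>
     ((\<lambda>h. (LINT x:{b - h<..<b}|lebesgue. \<bar>v x - s\<bar>) / h) \<longlongrightarrow> 0) (at_right 0)"

text \<open>
  Nonnegative \<open>C\<^sup>1\<close> functions of \<open>(t, x)\<close>, compactly supported in \<open>t < T\<close>, with
  partial derivatives \<open>\<phi>t\<close> and \<open>\<phi>x\<close>. They need not vanish at \<open>t = 0\<close>, \<open>x = a\<close> or \<open>x = b\<close>.
\<close>

definition test_function ::
    "real \<Rightarrow> (real \<times> real \<Rightarrow> real) \<Rightarrow> (real \<times> real \<Rightarrow> real) \<Rightarrow> (real \<times> real \<Rightarrow> real) \<Rightarrow> bool" where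
  "test_function T \<phi> \<phi>t \<phi>x \<longleftrightarrow>
     (\<forall>p. 0 \<le> \<phi> p) \<and>
     (\<forall>p. (\<phi> has_derivative (\<lambda>h. \<phi>t p * fst h + \<phi>x p * snd h)) (at p)) \<and>
     continuous_on UNIV \<phi>t \<and> continuous_on UNIV \<phi>x \<and>
     compact (closure {p. \<phi> p \<noteq> 0}) \<and>
     closure {p. \<phi> p \<noteq> 0} \<subseteq> {..<T} \<times> UNIV"

text \<open>
  Bardos--Le Roux--Nedelec solutions: the boundary data \<open>\<omega>a\<close>, \<open>\<omega>b\<close> are attained in the weak sense encoded by
  the two boundary terms of the entropy inequality, and need not coincide with the traces \<open>ua\<close>, \<open>ub\<close>.
  Only Kruzhkov constants in \<open>{0..umax}\<close> occur, as the flux is defined there only.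
  The solution is the representative that is continuous in time with values in \<open>L\<^sup>1\<close>,
  which gives a meaning to \<open>u t\<close> at every single time.
\<close>

definition weak_entropy_solution ::
    "real \<Rightarrow> (real \<Rightarrow> real) \<Rightarrow> real \<Rightarrow> real \<Rightarrow> real \<Rightarrow> (real \<Rightarrow> real) \<Rightarrow> (real \<Rightarrow> real) \<Rightarrow> (real \<Rightarrow> real) \<Rightarrow>
     (real \<Rightarrow> real \<Rightarrow> real) \<Rightarrow> (real \<Rightarrow> real) \<Rightarrow> (real \<Rightarrow> real) \<Rightarrow> bool" where
  "weak_entropy_solution umax f a b T u0 \<omega>a \<omega>b u ua ub \<longleftrightarrow>
     set_borel_measurable lebesgue ({0..T} \<times> {a<..<b}) (\<lambda>(\<tau>, x). u \<tau> x) \<and>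
     (\<forall>\<tau>\<in>{0..T}. set_borel_measurable lebesgue {a<..<b} (u \<tau>)) \<and>
     (\<forall>\<tau>\<in>{0..T}. \<forall>x\<in>{a<..<b}. u \<tau> x \<in> {0..umax}) \<and>
     (\<forall>\<tau>\<in>{0..T}. ((\<lambda>r. LINT x:{a<..<b}|lebesgue. \<bar>u r x - u \<tau> x\<bar>) \<longlongrightarrow> 0) (at \<tau> within {0..T})) \<and>
     (AE x in lebesgue. x \<in> {a<..<b} \<longrightarrow> u 0 x = u0 x) \<and>
     set_borel_measurable lebesgue {0..T} ua \<and>
     set_borel_measurable lebesgue {0..T} ub \<and>
     (AE \<tau> in lebesgue. \<tau> \<in> {0..T} \<longrightarrow> left_trace a (u \<tau>) (ua \<tau>)) \<and>
     (AE \<tau> in lebesgue. \<tau> \<in> {0..T} \<longrightarrow> right_trace b (u \<tau>) (ub \<tau>)) \<and>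
     (\<forall>\<kappa>\<in>{0..umax}. \<forall>\<phi> \<phi>t \<phi>x. test_function T \<phi> \<phi>t \<phi>x \<longrightarrow>
        0 \<le> (LINT (\<tau>, x):{0..T} \<times> {a<..<b}|lebesgue.
               \<bar>u \<tau> x - \<kappa>\<bar> * \<phi>t (\<tau>, x) + sgn (u \<tau> x - \<kappa>) * (f (u \<tau> x) - f \<kappa>) * \<phi>x (\<tau>, x))
          + (LINT x:{a<..<b}|lebesgue. \<bar>u0 x - \<kappa>\<bar> * \<phi> (0, x))
          + (LINT \<tau>:{0..T}|lebesgue. sgn (\<omega>a \<tau> - \<kappa>) * (f (ua \<tau>) - f \<kappa>) * \<phi> (\<tau>, a))
          - (LINT \<tau>:{0..T}|lebesgue. sgn (\<omega>b \<tau> - \<kappa>) * (f (ub \<tau>) - f \<kappa>) * \<phi> (\<tau>, b)))"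


section \<open>Lyapunov and barrier functionals and the boundary control constraints\<close>

definition lyapunov :: "real \<Rightarrow> real \<Rightarrow> real \<Rightarrow> (real \<Rightarrow> real) \<Rightarrow> real" where
  "lyapunov a b ustar v = 1 / 2 * (LINT x:{a<..<b}|lebesgue. (v x - ustar)\<^sup>2)"

definition barrier :: "real \<Rightarrow> real \<Rightarrow> real \<Rightarrow> (real \<Rightarrow> real) \<Rightarrow> real" where
  "barrier a b ubar v = ubar\<^sup>2 - (LINT x:{a<..<b}|lebesgue. (v x)\<^sup>2)"

definition class_K :: "(real \<Rightarrow> real) \<Rightarrow> bool" where
  "class_K \<alpha> \<longleftrightarrow> continuous_on {0..} \<alpha> \<and> strict_mono_on {0..} \<alpha> \<and> \<alpha> 0 = 0"

definition g_fun :: "(real \<Rightarrow> real) \<Rightarrow> (real \<Rightarrow> real) \<Rightarrow> real \<Rightarrow> real \<Rightarrow> real \<Rightarrow> real" where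
  "g_fun f F ustar s z = (s - ustar) * f s - (z - ustar) * f z - F s + F z"

definition k_fun :: "(real \<Rightarrow> real) \<Rightarrow> (real \<Rightarrow> real) \<Rightarrow> real \<Rightarrow> real \<Rightarrow> real" where
  "k_fun f F s z = s * f s - z * f z - F s + F z"

definition C_b :: "real \<Rightarrow> (real \<Rightarrow> real) \<Rightarrow> (real \<Rightarrow> real) \<Rightarrow> real \<Rightarrow> real set" where
  "C_b umax f' f'' ustar = {v \<in> {0..umax}. (v - ustar) * f'' v + f' v \<le> 0}"

end

theory Submission
  imports Defs
begin

text \<open>
  For every \<open>c\<close> the function \<open>h v = (v - c) * f v - F v\<close> has derivative \<open>(v - c) * f' v\<close>, and both constraint
  functions are differences \<open>h s - h z\<close>, with \<open>c = ustar\<close> for \<open>g\<close> and \<open>c = 0\<close> for \<open>k\<close>. Let \<open>vm\<close> be the maximum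
  point of \<open>f\<close> and \<open>s\<close> the left trace. For \<open>c = 0\<close> the function \<open>h\<close> has its strict maximum at \<open>vm\<close>, so if
  \<open>s \<noteq> vm\<close> then \<open>ustar = 0\<close> and the control \<open>vm\<close> make both constraint functions negative. If \<open>s = vm\<close> and the
  barrier is positive, then \<open>ustar = umax\<close> and the control \<open>umax\<close> make \<open>g\<close> negative, and a steep \<open>\<beta>\<close> takes
  care of \<open>k\<close>. In the remaining case \<open>u t\<close> is at the equilibrium \<open>ustar = s\<close>, which the control \<open>s\<close> preserves.
\<close>

text \<open>A point outside \<open>S\<close> has a positive distance \<open>d\<close> to it, so
  every average of \<open>\<bar>v x - s\<bar>\<close> near \<open>a\<close> is at least
  \<open>d\<close> and cannot tend to 0. Boundedness of \<open>S\<close> makes these integrals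
  genuine ones.\<close>

lemma left_trace_mem:
  fixes v :: "real \<Rightarrow> real"
  assumes "a < b" and meas: "set_borel_measurable lebesgue {a<..<b} v"
    and S: "closed S" "bounded S" and vS: "\<And>x. x \<in> {a<..<b} \<Longrightarrow> v x \<in> S"
    and trace: "left_trace a v s"
  shows "s \<in> S"
proof (rule ccontr)
  assume "s \<notin> S"
  then obtain d where d: "d > 0" "\<And>y. y \<in> S \<Longrightarrow> d \<le> dist s y"
    using separate_point_closed[OF S(1)] by blast
  obtain M where M: "\<And>y. y \<in> S \<Longrightarrow> \<bar>y\<bar> \<le> M"
    using S(2) by (auto simp: bounded_iff)
  have *: "d \<le> (LINT x:{a<..<a + h}|lebesgue. \<bar>v x - s\<bar>) / h" if h: "0 < h" "h < b - a" for h
  proof -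
    let ?I = "{a<..<a + h}"
    have sub: "?I \<subseteq> {a<..<b}" using h by auto
    have "set_borel_measurable lebesgue ?I v"
      by (rule set_borel_measurable_subset[OF meas]) (use sub in auto)
    then have m0: "(\<lambda>x. indicat_real ?I x *\<^sub>R v x) \<in> borel_measurable lebesgue"
      unfolding set_borel_measurable_def .
    \<comment> \<open>Only the cut-off of \<open>v\<close> is known to be measurable, so a second
      indicator is placed inside the absolute value and then dropped.\<close>
    have "(\<lambda>x. indicat_real ?I x *\<^sub>R \<bar>indicat_real ?I x *\<^sub>R v x - s\<bar>) \<in> borel_measurable lebesgue"
      by (intro borel_measurable_scaleR borel_measurable_indicator borel_measurable_abs
          borel_measurable_diff m0 borel_measurable_const) simp
    also have "(\<lambda>x. indicat_real ?I x *\<^sub>R \<bar>indicat_real ?I x *\<^sub>R v x - s\<bar>)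
        = (\<lambda>x. indicat_real ?I x *\<^sub>R \<bar>v x - s\<bar>)"
      by (auto simp: indicator_def)
    finally have m: "set_borel_measurable lebesgue ?I (\<lambda>x. \<bar>v x - s\<bar>)"
      unfolding set_borel_measurable_def .
    have const: "set_integrable lebesgue ?I (\<lambda>x. c)" for c :: real
      unfolding set_integrable_def by (intro integrable_real_indicator integrable_scaleR_left) (use h in auto)
    have int: "set_integrable lebesgue ?I (\<lambda>x. \<bar>v x - s\<bar>)"
    proof (rule set_integrable_bound[OF const[of "M + \<bar>s\<bar>"] m], intro AE_I2 impI)
      fix x assume "x \<in> ?I"
      then show "norm \<bar>v x - s\<bar> \<le> norm (M + \<bar>s\<bar>)"
        using M[OF vS[of x]] sub by auto
    qed
    have "d * h = (LINT x:?I|lebesgue. d)"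
      using h by (simp add: set_lebesgue_integral_def)
    also have "\<dots> \<le> (LINT x:?I|lebesgue. \<bar>v x - s\<bar>)"
      using d(2)[OF vS] sub by (intro set_integral_mono const int) (force simp: dist_real_def)
    finally show ?thesis using h by (simp add: field_simps)
  qed
  have "eventually (\<lambda>h. d \<le> (LINT x:{a<..<a + h}|lebesgue. \<bar>v x - s\<bar>) / h) (at_right 0)"
    unfolding eventually_at_right_field using * \<open>a < b\<close> by (intro exI[of _ "b - a"]) auto
  from tendsto_lowerbound[OF trace[unfolded left_trace_def] this] d(1) show False by simp
qed

lemma class_K_linear: "0 < c \<Longrightarrow> class_K (\<lambda>x. c * x)"
  by (auto simp: class_K_def strict_mono_on_def intro!: continuous_intros)

lemma lyapunov_nonneg: "0 \<le> lyapunov a b c v"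
  by (simp add: lyapunov_def set_lebesgue_integral_def)

lemma has_derivative_within_Icc_at:
  "(\<phi> has_real_derivative D) (at x within {l..r}) \<Longrightarrow> l < x \<Longrightarrow> x < r \<Longrightarrow>
     (\<phi> has_real_derivative D) (at x)"
  for \<phi> :: "real \<Rightarrow> real"
  by (simp add: at_within_Icc_at)

lemma concave_flux_deriv_strict_antimono:
  assumes "concave_flux umax f f' f''" and "0 \<le> v" "v < w" "w \<le> umax"
  shows "f' w < f' v"
proof (rule DERIV_neg_imp_decreasing_open[OF \<open>v < w\<close>])
  have d: "(f' has_real_derivative f'' x) (at x within {0..umax})" if "x \<in> {0..umax}" for x
    using assms(1) that by (auto simp: concave_flux_def)
  show "\<exists>D. (f' has_real_derivative D) (at x) \<and> D < 0" if "v < x" "x < w" for x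
    using has_derivative_within_Icc_at[OF d, of x] that assms by (auto simp: concave_flux_def)
  show "continuous_on {v..w} f'"
    using assms by (intro continuous_on_subset[OF DERIV_continuous_on[OF d]]) auto
qed

text \<open>Rolle's theorem, as \<open>f\<close> vanishes at both ends.\<close>

lemma concave_flux_critical_point:
  assumes "concave_flux umax f f' f''" and "0 < umax"
  obtains vm where "0 < vm" "vm < umax" "f' vm = 0"
proof -
  have d: "(f has_real_derivative f' x) (at x within {0..umax})" if "x \<in> {0..umax}" for x
    using assms(1) that by (auto simp: concave_flux_def)
  have "continuous_on {0..umax} f" by (rule DERIV_continuous_on[OF d])
  moreover have "f 0 = f umax" using assms(1) by (simp add: concave_flux_def)
  moreover have "(f has_derivative (*) (f' x)) (at x)" if "0 < x" "x < umax" for x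
    using has_derivative_within_Icc_at[OF d, of x] that by (simp add: has_field_derivative_def)
  ultimately have "\<exists>z. 0 < z \<and> z < umax \<and> (*) (f' z) = (\<lambda>h. 0)"
    using Rolle_deriv[OF \<open>0 < umax\<close>, of f "\<lambda>x. (*) (f' x)"] by blast
  then obtain z where z: "0 < z" "z < umax" "(*) (f' z) = (\<lambda>h. 0)"
    by blast
  then show thesis using that[of z] fun_cong[OF z(3), of 1] by simp
qed

text \<open>The sign condition says that \<open>h\<close> increases on the way from \<open>s\<close>
  to \<open>z\<close>, whichever of the two is larger. Two-sided derivatives exist inside the
  interval, and continuity suffices at its ends.\<close>

lemma g_fun_neg:
  assumes flux: "concave_flux umax f f' f''" and prim: "primitive_on {0..umax} f F"
    and s: "s \<in> {0..umax}" and z: "z \<in> {0..umax}" and "s \<noteq> z"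
    and sign: "\<And>x. min s z < x \<Longrightarrow> x < max s z \<Longrightarrow> 0 < (x - c) * f' x * (z - s)"
  shows "g_fun f F c s z < 0"
proof -
  define h where "h = (\<lambda>x. (x - c) * f x - F x)"
  have d: "(h has_real_derivative (x - c) * f' x) (at x within {0..umax})" if "x \<in> {0..umax}" for x
    using flux prim that unfolding h_def concave_flux_def primitive_on_def
    by (auto intro!: derivative_eq_intros)
  have cont: "continuous_on {p..q} h" if "0 \<le> p" "q \<le> umax" for p q
    using that by (intro continuous_on_subset[OF DERIV_continuous_on[OF d]]) auto
  have D: "(h has_real_derivative (x - c) * f' x) (at x)" if "min s z < x" "x < max s z" for x
    using has_derivative_within_Icc_at[OF d, of x] that s z by auto
  have "h s < h z"
  proof (cases "s < z")
    case True
    show ?thesis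
    proof (rule DERIV_pos_imp_increasing_open[OF True _ cont])
      fix x assume x: "s < x" "x < z"
      then have "0 < (x - c) * f' x"
        using sign[of x] by (intro zero_less_mult_pos2[of "(x - c) * f' x" "z - s"]) auto
      then show "\<exists>D. (h has_real_derivative D) (at x) \<and> 0 < D"
        using D[of x] x by auto
    qed (use s z in auto)
  next
    case False
    then have "z < s" using \<open>s \<noteq> z\<close> by simp
    then show ?thesis
    proof (rule DERIV_neg_imp_decreasing_open[OF _ _ cont])
      fix x assume x: "z < x" "x < s"
      then have "0 < (x - c) * f' x * (z - s)"
        using sign[of x] by auto
      then have "(x - c) * f' x < 0"
        using \<open>z < s\<close> zero_less_mult_iff[of "(x - c) * f' x" "z - s"] by linarith
      then show "\<exists>D. (h has_real_derivative D) (at x) \<and> D < 0"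
        using D[of x] x by auto
    qed (use s z in auto)
  qed
  then show ?thesis by (simp add: g_fun_def h_def)
qed

lemma k_fun_eq_g_fun: "k_fun f F = g_fun f F 0"
  by (simp add: k_fun_def g_fun_def fun_eq_iff)

text \<open>A linear function of slope \<open>- y / (V + 1)\<close> works since
  \<open>V / (V + 1) < 1\<close>; the added 1 also covers \<open>V = 0\<close>.\<close>

lemma ex_class_K_le_uminus:
  assumes "y < 0" "0 \<le> V"
  shows "\<exists>\<alpha>. class_K \<alpha> \<and> y \<le> - \<alpha> V"
proof -
  have "y \<le> - (- y / (V + 1) * V)"
    using assms by (simp add: field_simps)
  moreover have "0 < - y / (V + 1)" using assms by (intro divide_pos_pos) auto
  ultimately show ?thesis using class_K_linear by blast
qed

text \<open>Strict positivity of \<open>B\<close> is essential, as class K functions vanish at 0.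
  The added 1 keeps the slope positive when \<open>y = 0\<close>.\<close>

lemma ex_class_K_ge:
  assumes "0 < B"
  shows "\<exists>\<beta>. class_K \<beta> \<and> y \<le> \<beta> B"
proof -
  have "y \<le> (\<bar>y\<bar> + 1) / B * B" using assms by simp
  moreover have "0 < (\<bar>y\<bar> + 1) / B" using assms by simp
  ultimately show ?thesis using class_K_linear by blast
qed

theorem theorem2:
  fixes umax a b T t :: real
    and f f' f'' F u0 \<omega>a \<omega>b ua ub :: "real \<Rightarrow> real"
    and u :: "real \<Rightarrow> real \<Rightarrow> real"
  assumes "0 < umax" and "a < b" and "0 < T"
    and flux: "concave_flux umax f f' f''"
    and prim: "primitive_on {0..umax} f F"
    and C_b_interval: "\<And>ustar. ustar \<in> {0..umax} \<Longrightarrow>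
          \<exists>u1\<in>{0..umax}. u1 + f' u1 / f'' u1 = ustar \<and> C_b umax f' f'' ustar = {u1..umax}"
    and u0: "bounded_variation_on {a<..<b} u0" "u0 ` {a<..<b} \<subseteq> {0..umax}"
    and \<omega>a: "set_borel_measurable lebesgue {0..T} \<omega>a" "\<omega>a ` {0..T} \<subseteq> {0..umax}"
    and \<omega>b: "set_borel_measurable lebesgue {0..T} \<omega>b" "\<omega>b ` {0..T} \<subseteq> {0..umax}"
    and sol: "weak_entropy_solution umax f a b T u0 \<omega>a \<omega>b u ua ub"
    and t: "t \<in> {0..T}"
    and trace: "left_trace a (u t) (ua t)"
    and B_nonneg: "\<exists>ubar\<in>{0..umax}. 0 \<le> barrier a b ubar (u t)"
    and nondegenerate: "(\<exists>ubar\<in>{0..umax}. 0 < barrier a b ubar (u t)) \<or>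
          f' (ua t) \<noteq> 0 \<or> lyapunov a b (ua t) (u t) = 0"
  shows "\<exists>ubar\<in>{0..umax}. \<exists>ustar\<in>{0..umax}. \<exists>\<alpha> \<beta>. class_K \<alpha> \<and> class_K \<beta> \<and>
           0 \<le> barrier a b ubar (u t) \<and>
           (\<exists>\<omega>\<in>C_b umax f' f'' ustar.
              g_fun f F ustar (ua t) \<omega> \<le> - \<alpha> (lyapunov a b ustar (u t)) \<and>
              k_fun f F (ua t) \<omega> \<le> \<beta> (barrier a b ubar (u t)))"
proof -
  let ?s = "ua t" and ?B = "\<lambda>ubar. barrier a b ubar (u t)" and ?V = "\<lambda>ustar. lyapunov a b ustar (u t)"
  have s: "?s \<in> {0..umax}"
  proof (rule left_trace_mem[OF \<open>a < b\<close> _ closed_atLeastAtMost bounded_closed_interval _ trace])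
    show "set_borel_measurable lebesgue {a<..<b} (u t)"
      using sol t unfolding weak_entropy_solution_def by blast
    show "u t x \<in> {0..umax}" if "x \<in> {a<..<b}" for x
      using sol t that unfolding weak_entropy_solution_def by blast
  qed
  obtain vm where vm: "0 < vm" "vm < umax" "f' vm = 0"
    using concave_flux_critical_point[OF flux \<open>0 < umax\<close>] .
  note anti = concave_flux_deriv_strict_antimono[OF flux]
  have pos: "0 < f' x" if "0 \<le> x" "x < vm" for x using anti[of x vm] that vm by simp
  have neg: "f' x < 0" if "vm < x" "x \<le> umax" for x using anti[of vm x] that vm by simp
  have f''neg: "f'' x < 0" if "x \<in> {0..umax}" for x using flux that by (simp add: concave_flux_def)
  have vm_C_b: "vm \<in> C_b umax f' f'' 0"
    using vm f''neg[of vm] by (auto simp: C_b_def mult_le_0_iff)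
  have umax_C_b: "umax \<in> C_b umax f' f'' umax"
    using vm neg[of umax] by (simp add: C_b_def)
  \<comment> \<open>If \<open>?s = vm\<close>, then \<open>f' ?s = 0\<close>, which rules out the
    middle alternative of \<open>nondegenerate\<close>.\<close>
  consider (noncritical) "?s \<noteq> vm" | (barrier) ubar where "?s = vm" "ubar \<in> {0..umax}" "0 < ?B ubar"
    | (equilibrium) "?s = vm" "?V ?s = 0"
    using nondegenerate vm by metis
  then show ?thesis
  proof cases
    case noncritical
    have g: "g_fun f F 0 ?s vm < 0"
    proof (rule g_fun_neg[OF flux prim s _ noncritical])
      \<comment> \<open>Here \<open>x > 0\<close>, and \<open>f' x\<close> and
        \<open>vm - ?s\<close> have the same sign: positive to the left of \<open>vm\<close>,
        negative to the right.\<close>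
      fix x assume x: "min ?s vm < x" "x < max ?s vm"
      then show "0 < (x - 0) * f' x * (vm - ?s)"
        using s vm pos[of x] neg[of x] by (cases "?s < vm") (auto simp: zero_less_mult_iff mult_less_0_iff)
    qed (use vm in auto)
    obtain ubar where ubar: "ubar \<in> {0..umax}" "0 \<le> ?B ubar" using B_nonneg by blast
    obtain \<alpha> where \<alpha>: "class_K \<alpha>" "g_fun f F 0 ?s vm \<le> - \<alpha> (?V 0)"
      using ex_class_K_le_uminus[OF g lyapunov_nonneg] by blast
    have "k_fun f F ?s vm \<le> 1 * ?B ubar" using g ubar by (simp add: k_fun_eq_g_fun)
    then show ?thesis
      using ubar \<alpha> vm_C_b class_K_linear[of 1] \<open>0 < umax\<close>
      by (intro bexI[of _ ubar] bexI[of _ 0] exI[of _ \<alpha>] exI[of _ "\<lambda>x. 1 * x"] conjI bexI[of _ vm]) auto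
  next
    case (barrier ubar)
    \<comment> \<open>Between \<open>vm\<close> and \<open>umax\<close> both \<open>x - umax\<close>
      and \<open>f' x\<close> are negative.\<close>
    have g: "g_fun f F umax ?s umax < 0"
      by (rule g_fun_neg[OF flux prim s])
        (use barrier(1) vm neg in \<open>auto simp: zero_less_mult_iff mult_less_0_iff\<close>)
    obtain \<alpha> where \<alpha>: "class_K \<alpha>" "g_fun f F umax ?s umax \<le> - \<alpha> (?V umax)"
      using ex_class_K_le_uminus[OF g lyapunov_nonneg] by blast
    \<comment> \<open>For \<open>c = 0\<close> the function \<open>h\<close> decreases beyond
      \<open>vm\<close>, so \<open>k\<close> is positive here and the positive barrier has to absorb
      it.\<close>
    obtain \<beta> where "class_K \<beta>" "k_fun f F ?s umax \<le> \<beta> (?B ubar)"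
      using ex_class_K_ge[OF barrier(3)] by blast
    then show ?thesis
      using barrier \<alpha> umax_C_b \<open>0 < umax\<close>
      by (intro bexI[of _ ubar] bexI[of _ umax] exI[of _ \<alpha>] exI[of _ \<beta>] conjI bexI[of _ umax]) auto
  next
    case equilibrium
    obtain ubar where ubar: "ubar \<in> {0..umax}" "0 \<le> ?B ubar" using B_nonneg by blast
    \<comment> \<open>Both terms of the membership condition vanish. With control \<open>?s\<close>
      both constraint functions are 0, and so is the bound on \<open>g\<close>, since the Lyapunov
      functional is 0.\<close>
    have "?s \<in> C_b umax f' f'' ?s" using equilibrium vm by (simp add: C_b_def)
    then show ?thesis
      using ubar equilibrium(2) s class_K_linear[of 1]
      by (intro bexI[of _ ubar] bexI[of _ ?s] exI[of _ "\<lambda>x. 1 * x"] conjI bexI[of _ ?s])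
        (auto simp: g_fun_def k_fun_def)
  qed
qed

end
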